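(* For every integer $k\geq 1$, the median hypersimplex $\Delta_{2k,k}$ represents a ray in the deformation cone of the permutahedron $P_{2k}$ (the submodular cone). That is, $\Delta_{2k,k}$ is a deformation of $P_{2k}$, and its class in the essential deformation cone $Def_{ess}(P_{2k})$ is nonzero and spans a one-dimensional face (an extreme ray) of this cone.
   Context: The hypersimplex $\Delta_{n,r}\subset\mathbb{R}^n$ is the convex hull of all $0/1$-vectors in $\mathbb{R}^n$ with coordinate sum $r$; $\Delta_{2k,k}$ is called the median hypersimplex. The permutahedron $P_n\subset\mathbb{R}^n$ is the convex hull of all permutations of the vector $(1,2,\dots,n)$. For a convex polytope $P\subset\mathbb{R}^d$ with normal fan $\mathcal{N}(P)$, a polytope $Q\subset\mathbb{R}^d$ is a deformation of $P$ if $\mathcal{N}(Q)$ is a coarsening of $\mathcal{N}(P)$ (every cone of $\mathcal{N}(Q)$ is a union of cones of $\mathcal{N}(P)$); equivalently, $Q$ is a Minkowski summand of a dilate $\lambda P$, $\lambda>0$. The deformation cone $Def(P)$ is the set of all deformations of $P$, regarded as a convex cone by identifying a polytope $Q$ with its support function $y\mapsto\max_{x\in Q}\langle y,x\rangle$; sums of support functions correspond to Minkowski sums and positive multiples to dilations. The essential deformation cone $Def_{ess}(P)$ is the pointed cone obtained as the quotient of $Def(P)$ by its lineality space, i.e. by the translations (polytopes are considered modulo translation; in terms of support functions, modulo linear functionals). The deformation cone of the permutahedron is also called the submodular cone, and the rays of $Def(P)$ are by convention the rays of $Def_{ess}(P)$. *)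

theory Defs
  imports "HOL-Analysis.Analysis"
begin

text \<open>The coordinates of \<open>\<real>\<^sup>n\<close> are indexed by a finite type \<open>'n\<close> with \<open>CARD('n) = n\<close>.\<close>

definition hypersimplex :: "nat \<Rightarrow> (real ^ 'n) set" where
  "hypersimplex r =
     convex hull {x. (\<forall>i. x $ i = 0 \<or> x $ i = 1) \<and> (\<Sum>i\<in>UNIV. x $ i) = real r}"

text \<open>A permutation of \<open>(1, \<dots>, n)\<close> is a vector whose coordinate function is a bijection from
  the index type onto \<open>{1, \<dots>, n}\<close>; no ordering of the index type has to be chosen.\<close>

definition permutahedron :: "(real ^ 'n) set" where
  "permutahedron = convex hull {x. bij_betw (\<lambda>i. x $ i) UNIV (real ` {1..CARD('n)})}"

definition normal_cone :: "'a::euclidean_space set \<Rightarrow> 'a set \<Rightarrow> 'a set" where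
  "normal_cone P F = {y. \<forall>x\<in>F. \<forall>z\<in>P. y \<bullet> z \<le> y \<bullet> x}"

definition normal_fan :: "'a::euclidean_space set \<Rightarrow> 'a set set" where
  "normal_fan P = {normal_cone P F | F. F face_of P \<and> F \<noteq> {}}"

text \<open>Polytopes are nonempty here; the library's \<^const>\<open>polytope\<close> admits the empty set.\<close>

definition deformation_of :: "'a::euclidean_space set \<Rightarrow> 'a set \<Rightarrow> bool"
    (infix \<open>deformation'_of\<close> 50) where
  "Q deformation_of P \<longleftrightarrow> polytope Q \<and> Q \<noteq> {} \<and>
     (\<forall>C\<in>normal_fan Q. \<exists>\<S>\<subseteq>normal_fan P. C = \<Union>\<S>)"

text \<open>On a nonempty compact set the supremum is a maximum.\<close>

definition support_function :: "'a::euclidean_space set \<Rightarrow> 'a \<Rightarrow> real" where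
  "support_function Q y = (SUP x\<in>Q. y \<bullet> x)"

definition deformation_cone :: "'a::euclidean_space set \<Rightarrow> ('a \<Rightarrow> real) set" where
  "deformation_cone P = support_function ` {Q. Q deformation_of P}"

text \<open>The vector space of real functions, with pointwise operations, modulo the subspace of
  linear functionals.\<close>

quotient_type (overloaded) 'a fun_mod_linear =
  "'a::euclidean_space \<Rightarrow> real" / "\<lambda>f g. linear (\<lambda>y. f y - g y)"
  morphisms rep_mod_linear mod_linear
proof (rule equivpI)
  show "reflp (\<lambda>f g :: 'a \<Rightarrow> real. linear (\<lambda>y. f y - g y))"
    by (rule reflpI) (simp add: linear_iff)
  show "symp (\<lambda>f g :: 'a \<Rightarrow> real. linear (\<lambda>y. f y - g y))"
  proof (rule sympI)
    fix f g :: "'a \<Rightarrow> real"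
    assume "linear (\<lambda>y. f y - g y)"
    from linear_compose_neg[OF this] show "linear (\<lambda>y. g y - f y)" by simp
  qed
  show "transp (\<lambda>f g :: 'a \<Rightarrow> real. linear (\<lambda>y. f y - g y))"
  proof (rule transpI)
    fix f g h :: "'a \<Rightarrow> real"
    assume "linear (\<lambda>y. f y - g y)" "linear (\<lambda>y. g y - h y)"
    from linear_compose_add[OF this] show "linear (\<lambda>y. f y - h y)" by simp
  qed
qed

instantiation fun_mod_linear :: (euclidean_space) real_vector
begin

lift_definition zero_fun_mod_linear :: "'a fun_mod_linear" is "\<lambda>_. 0" .

lift_definition plus_fun_mod_linear ::
    "'a fun_mod_linear \<Rightarrow> 'a fun_mod_linear \<Rightarrow> 'a fun_mod_linear"
  is "\<lambda>f g y. f y + g y"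
  by (drule (1) linear_compose_add) (simp add: algebra_simps)

lift_definition uminus_fun_mod_linear :: "'a fun_mod_linear \<Rightarrow> 'a fun_mod_linear"
  is "\<lambda>f y. - f y"
  by (drule linear_compose_neg) (simp add: algebra_simps)

lift_definition minus_fun_mod_linear ::
    "'a fun_mod_linear \<Rightarrow> 'a fun_mod_linear \<Rightarrow> 'a fun_mod_linear"
  is "\<lambda>f g y. f y - g y"
  by (drule (1) linear_compose_sub) (simp add: algebra_simps)

lift_definition scaleR_fun_mod_linear :: "real \<Rightarrow> 'a fun_mod_linear \<Rightarrow> 'a fun_mod_linear"
  is "\<lambda>c f y. c * f y"
  subgoal for c f g
    using linear_compose_scale_right[of "\<lambda>y. f y - g y" c] by (simp add: algebra_simps)
  done

instance
  by standard (transfer, simp add: algebra_simps linear_iff)+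

end

lemma mod_linear_eq_0_iff: "mod_linear f = 0 \<longleftrightarrow> linear f"
  by transfer simp

definition essential_deformation_cone ::
    "'a::euclidean_space set \<Rightarrow> 'a fun_mod_linear set" where
  "essential_deformation_cone P = mod_linear ` deformation_cone P"

text \<open>The linear functionals are the lineality space of the deformation cone, so the quotient
  above is the one by the lineality space.\<close>

lemma support_function_upper:
  assumes "polytope Q" "x \<in> Q"
  shows "y \<bullet> x \<le> support_function Q y"
  unfolding support_function_def
proof (rule cSUP_upper[OF assms(2)])
  have "compact ((\<lambda>x. y \<bullet> x) ` Q)"
    using polytope_imp_compact[OF assms(1)]
    by (intro compact_continuous_image continuous_intros)
  then show "bdd_above ((\<lambda>x. y \<bullet> x) ` Q)"
    by (intro bounded_imp_bdd_above compact_imp_bounded)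
qed

lemma support_function_subadditive:
  assumes "polytope Q" "Q \<noteq> {}"
  shows "support_function Q (y + z) \<le> support_function Q y + support_function Q z"
  unfolding support_function_def[of Q "y + z"]
  using assms support_function_upper[OF assms(1)]
  by (intro cSUP_least) (auto simp: inner_add_left intro: add_mono)

lemma support_function_scale:
  assumes "polytope Q" "Q \<noteq> {}" "c > 0"
  shows "support_function Q (c *\<^sub>R y) = c * support_function Q y"
proof -
  have le: "support_function Q (c *\<^sub>R y) \<le> c * support_function Q y" if "c > 0" for c y
    unfolding support_function_def[of Q "c *\<^sub>R y"]
    using assms that support_function_upper[OF assms(1)]
    by (intro cSUP_least) auto
  from le[of "1 / c" "c *\<^sub>R y"] assms(3)
  have "c * support_function Q y \<le> support_function Q (c *\<^sub>R y)"
    by (simp add: field_simps)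
  with le[OF assms(3), of y] show ?thesis by simp
qed

lemma Union_normal_fan:
  fixes P :: "'a::euclidean_space set"
  assumes "polytope P" "P \<noteq> {}"
  shows "\<Union> (normal_fan P) = UNIV"
proof -
  have "y \<in> \<Union> (normal_fan P)" for y
  proof -
    have "continuous_on P (\<lambda>x. y \<bullet> x)" by (intro continuous_intros)
    from continuous_attains_sup[OF polytope_imp_compact[OF assms(1)] assms(2) this]
    obtain x where x: "x \<in> P" "\<forall>z\<in>P. y \<bullet> z \<le> y \<bullet> x" by blast
    let ?F = "P \<inter> {z. y \<bullet> z = y \<bullet> x}"
    have "?F face_of P"
      using x by (intro face_of_Int_supporting_hyperplane_le polytope_imp_convex assms) auto
    moreover have "?F \<noteq> {}" using x by auto
    moreover have "y \<in> normal_cone P ?F"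
      using x by (auto simp: normal_cone_def)
    ultimately show ?thesis by (auto simp: normal_fan_def)
  qed
  then show ?thesis by blast
qed

lemma lineality_deformation_cone:
  fixes P :: "'a::euclidean_space set"
  assumes "polytope P" "P \<noteq> {}"
  shows "{f \<in> deformation_cone P. (\<lambda>y. - f y) \<in> deformation_cone P} = {f. linear f}"
proof -
  have linear_in: "f \<in> deformation_cone P" if "linear f" for f
  proof -
    define a where "a = adjoint f 1"
    have "f y = y \<bullet> a" for y
      using adjoint_works[OF that, of y 1] by (simp add: a_def)
    then have f: "f = support_function {a}"
      by (auto simp: support_function_def)
    have "normal_fan {a} \<subseteq> {UNIV}"
      by (auto simp: normal_fan_def normal_cone_def dest: face_of_imp_subset)
    then have "{a} deformation_of P"
      using Union_normal_fan[OF assms]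
      unfolding deformation_of_def by (metis polytope_sing insert_not_empty singletonD subsetD subset_refl)
    then show ?thesis by (auto simp: deformation_cone_def f)
  qed
  have "linear f" if f: "f \<in> deformation_cone P" and g: "(\<lambda>y. - f y) \<in> deformation_cone P" for f
  proof -
    obtain Q where Q: "f = support_function Q" "polytope Q" "Q \<noteq> {}"
      using f by (auto simp: deformation_cone_def deformation_of_def)
    obtain R where R: "(\<lambda>y. - f y) = support_function R" "polytope R" "R \<noteq> {}"
      using g by (auto simp: deformation_cone_def deformation_of_def)
    have add: "f (y + z) = f y + f z" for y z
    proof (rule antisym)
      show "f (y + z) \<le> f y + f z"
        using support_function_subadditive[OF Q(2,3)] Q(1) by simp
      show "f y + f z \<le> f (y + z)"
        using support_function_subadditive[OF R(2,3), of y z] R(1)[symmetric] by simp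
    qed
    have zero: "f 0 = 0" using add[of 0 0] by simp
    have pos: "f (c *\<^sub>R y) = c * f y" if "c > 0" for c y
      using support_function_scale[OF Q(2,3) that] Q(1) by simp
    have neg: "f (- y) = - f y" for y
      using add[of y "- y"] zero by simp
    have "f (c *\<^sub>R y) = c * f y" for c y
      using pos[of c y] pos[of "- c" y] neg[of "c *\<^sub>R y"] zero
      by (cases "c = 0") (auto simp: not_less not_le neq_iff)
    with add show ?thesis by (intro linearI) auto
  qed
  moreover have "linear (\<lambda>y. - f y)" if "linear f" for f :: "'a \<Rightarrow> real"
    using linear_compose_neg[OF that] .
  ultimately show ?thesis using linear_in by auto
qed

end

theory Submission
  imports Defs
begin

text \<open>The support function \<open>h\<close> of the hypersimplex adds up the \<open>k\<close> largest coordinates, so it is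
  linear on the cone \<open>C\<^sub>S\<close> of all vectors whose coordinates in the \<open>k\<close>-set \<open>S\<close> dominate the other ones.
  If \<open>f + g = c h\<close> with \<open>f\<close> and \<open>g\<close> sublinear, then \<open>f\<close> is additive on each \<open>C\<^sub>S\<close>. This cone is
  generated by \<open>e\<^sub>i\<close> for \<open>i \<in> S\<close>, by \<open>-e\<^sub>j\<close> for \<open>j \<notin> S\<close>, and by \<open>\<plusminus>(1,\<dots>,1)\<close>, so \<open>f\<close> is determined by
  its values on these vectors. Comparing the two expressions of the indicator vector of \<open>S\<close> for
  different \<open>S\<close> shows that \<open>f(e\<^sub>i) + f(-e\<^sub>i)\<close> does not depend on \<open>i\<close>, and \<open>f\<close> is this constant times \<open>h\<close>
  up to a linear functional. This needs only convexity of the two summands.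

  For the deformation property, a vector \<open>z\<close> in the normal cone of the face of the permutahedron
  maximizing \<open>y\<close> is weakly ordered like \<open>y\<close>: some maximizing permutation respects any prescribed
  inequality \<open>y\<^sub>j \<le> y\<^sub>i\<close>, because swapping two coordinates does not decrease the objective.\<close>

section \<open>Sets of largest coordinates\<close>

lemma finite_obtains_maximizer:
  fixes f :: "'a \<Rightarrow> 'b::linorder"
  assumes "finite A" "A \<noteq> {}"
  obtains x where "x \<in> A" "\<And>y. y \<in> A \<Longrightarrow> f y \<le> f x"
proof -
  have "Max (f ` A) \<in> f ` A" using assms by simp
  then obtain x where "x \<in> A" "f x = Max (f ` A)" by (metis imageE)
  with assms show ?thesis by (intro that) auto
qed

text \<open>This is membership of \<open>y\<close> in the cone \<open>C\<^sub>S\<close> described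
  above: the normal cone of the hypersimplex at the vertex with support \<open>S\<close>.\<close>

definition dominating :: "'n set \<Rightarrow> (real ^ 'n) \<Rightarrow> bool" where
  "dominating S y \<longleftrightarrow> (\<forall>i\<in>S. \<forall>j. j \<notin> S \<longrightarrow> y $ j \<le> y $ i)"

lemma dominating_0 [simp]: "dominating S 0"
  by (simp add: dominating_def)

lemma dominating_add: "dominating S y \<Longrightarrow> dominating S z \<Longrightarrow> dominating S (y + z)"
  by (auto simp: dominating_def intro: add_mono)

lemma dominating_scaleR: "c \<ge> 0 \<Longrightarrow> dominating S y \<Longrightarrow> dominating S (c *\<^sub>R y)"
  by (auto simp: dominating_def intro: mult_left_mono)

lemma dominating_sum: "(\<And>i. i \<in> A \<Longrightarrow> dominating S (u i)) \<Longrightarrow> dominating S (\<Sum>i\<in>A. u i)"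
  by (induction A rule: infinite_finite_induct) (auto intro: dominating_add)

text \<open>A separating level turns pairwise comparisons into signs of \<open>y $ i - t\<close>.
  The minimum over \<open>S\<close> works unless \<open>S\<close> is empty; then the overall maximum
  does.\<close>

lemma dominating_threshold:
  fixes y :: "real ^ 'n::finite"
  assumes "dominating S y"
  obtains t where "\<And>i. i \<in> S \<Longrightarrow> t \<le> y $ i" "\<And>j. j \<notin> S \<Longrightarrow> y $ j \<le> t"
proof (cases "S = {}")
  case True
  show ?thesis
    by (rule that[of "Max (range (\<lambda>i. y $ i))"]) (auto simp: True)
next
  case False
  show ?thesis
  proof (rule that[of "Min ((\<lambda>i. y $ i) ` S)"])
    fix j assume "j \<notin> S"
    then show "y $ j \<le> Min ((\<lambda>i. y $ i) ` S)"
      using assms False by (auto simp: dominating_def)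
  qed auto
qed

text \<open>Subtracting a threshold \<open>t\<close> from every coordinate shifts both sums equally,
  since the cardinalities agree. Afterwards terms outside \<open>S\<close> are at most 0 and terms
  in \<open>S\<close> at least 0, so the sum grows from \<open>T\<close> to
  \<open>T \<inter> S\<close> to \<open>S\<close>.\<close>

lemma sum_le_sum_dominating:
  fixes y :: "real ^ 'n::finite"
  assumes "dominating S y" "card T = card S"
  shows "(\<Sum>i\<in>T. y $ i) \<le> (\<Sum>i\<in>S. y $ i)"
proof -
  obtain t where t: "\<And>i. i \<in> S \<Longrightarrow> t \<le> y $ i" "\<And>j. j \<notin> S \<Longrightarrow> y $ j \<le> t"
    using dominating_threshold[OF assms(1)] by blast
  have "(\<Sum>i\<in>T. y $ i - t) \<le> (\<Sum>i\<in>T \<inter> S. y $ i - t)"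
  proof -
    have "(\<Sum>i\<in>T. y $ i - t) = (\<Sum>i\<in>T \<inter> S. y $ i - t) + (\<Sum>i\<in>T - S. y $ i - t)"
      by (rule sum.Int_Diff) simp
    moreover have "(\<Sum>i\<in>T - S. y $ i - t) \<le> 0"
      by (rule sum_nonpos) (use t(2) in auto)
    ultimately show ?thesis by simp
  qed
  also have "\<dots> \<le> (\<Sum>i\<in>S. y $ i - t)"
    by (rule sum_mono2) (use t(1) in auto)
  finally show ?thesis
    using assms(2) by (simp add: sum_subtractf)
qed

text \<open>Exchange argument: replacing \<open>i\<close> by \<open>j\<close> in \<open>S\<close>
  keeps the cardinality, so it cannot increase the sum.\<close>

lemma dominating_if_sum_maximal:
  fixes y :: "real ^ 'n::finite"
  assumes "\<And>T. card T = card S \<Longrightarrow> (\<Sum>i\<in>T. y $ i) \<le> (\<Sum>i\<in>S. y $ i)"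
  shows "dominating S y"
  unfolding dominating_def
proof (intro ballI allI impI)
  fix i j assume ij: "i \<in> S" "j \<notin> S"
  have "card (insert j (S - {i})) = card S"
    using ij card_Suc_Diff1[of S i] by simp
  from assms[OF this] have "y $ j + (\<Sum>l\<in>S - {i}. y $ l) \<le> (\<Sum>l\<in>S. y $ l)"
    using ij by simp
  also have "\<dots> = y $ i + (\<Sum>l\<in>S - {i}. y $ l)"
    using ij by (simp add: sum.remove)
  finally show "y $ j \<le> y $ i" by simp
qed

text \<open>Choosing a \<open>k\<close>-set of maximal coordinate sum avoids sorting the
  coordinates.\<close>

lemma ex_dominating:
  fixes y :: "real ^ 'n::finite"
  assumes "k \<le> CARD('n)"
  obtains S where "card S = k" "dominating S y"
proof -
  let ?K = "{S :: 'n set. card S = k}"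
  have "?K \<noteq> {}"
    using obtain_subset_with_card_n[OF assms] by blast
  then obtain S where S: "S \<in> ?K" "\<And>T. T \<in> ?K \<Longrightarrow> (\<Sum>i\<in>T. y $ i) \<le> (\<Sum>i\<in>S. y $ i)"
    using finite_obtains_maximizer[of ?K "\<lambda>T. \<Sum>i\<in>T. y $ i"] by (metis finite)
  then show ?thesis
    using dominating_if_sum_maximal[of S y] that by auto
qed

section \<open>The hypersimplex\<close>

definition indicator_vec :: "'n set \<Rightarrow> real ^ 'n" where
  "indicator_vec S = (\<chi> i. if i \<in> S then 1 else 0)"

lemma indicator_vec_nth [simp]: "indicator_vec S $ i = (if i \<in> S then 1 else 0)"
  by (simp add: indicator_vec_def)

lemma inner_indicator_vec: "y \<bullet> indicator_vec S = (\<Sum>i\<in>S. y $ i)"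
  for y :: "real ^ 'n::finite"
  by (simp add: inner_vec_def if_distrib[of "\<lambda>x. _ * x"] sum.If_cases cong: if_cong)

text \<open>A 0/1-vector is encoded by its support, so that the vertices become the
  \<open>k\<close>-subsets of the index type.\<close>

lemma hypersimplex_eq_hull:
  "(hypersimplex r :: (real ^ 'n::finite) set) = convex hull (indicator_vec ` {S. card S = r})"
proof -
  have sum: "(\<Sum>i\<in>UNIV. indicator_vec S $ i) = real (card S)" for S :: "'n set"
    by (simp add: sum.If_cases)
  have "x \<in> indicator_vec ` {S. card S = r}"
    if x: "\<forall>i. x $ i = 0 \<or> x $ i = 1" "(\<Sum>i\<in>UNIV. x $ i) = real r" for x :: "real ^ 'n"
  proof
    show "x = indicator_vec {i. x $ i = 1}"
      using x(1) by (auto simp: vec_eq_iff)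
    with x(2) sum[of "{i. x $ i = 1}"] show "{i. x $ i = 1} \<in> {S. card S = r}"
      by simp
  qed
  then have "{x :: real ^ 'n. (\<forall>i. x $ i = 0 \<or> x $ i = 1) \<and> (\<Sum>i\<in>UNIV. x $ i) = real r}
      = indicator_vec ` {S. card S = r}"
    using sum by auto
  then show ?thesis by (simp add: hypersimplex_def)
qed

lemma polytope_hypersimplex: "polytope (hypersimplex r :: (real ^ 'n::finite) set)"
  unfolding polytope_def hypersimplex_eq_hull by (intro exI conjI finite_imageI) auto

lemma indicator_vec_in_hypersimplex:
  "indicator_vec S \<in> (hypersimplex (card S) :: (real ^ 'n::finite) set)"
  unfolding hypersimplex_eq_hull by (intro hull_inc) auto

lemma hypersimplex_nonempty:
  assumes "r \<le> CARD('n)"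
  shows "(hypersimplex r :: (real ^ 'n::finite) set) \<noteq> {}"
proof -
  obtain S :: "'n set" where "card S = r"
    using obtain_subset_with_card_n[OF assms] by metis
  then show ?thesis
    using indicator_vec_in_hypersimplex[of S] by auto
qed

section \<open>The support function of the hypersimplex\<close>

lemma inner_le_on_hull:
  assumes "\<And>v. v \<in> V \<Longrightarrow> y \<bullet> v \<le> m" "w \<in> convex hull V"
  shows "y \<bullet> w \<le> m"
  using hull_minimal[of V "{x. y \<bullet> x \<le> m}" convex] assms convex_halfspace_le[of y m] by auto

lemma inner_hypersimplex_le:
  fixes y :: "real ^ 'n::finite"
  assumes "dominating S y" "w \<in> hypersimplex (card S)"
  shows "y \<bullet> w \<le> (\<Sum>i\<in>S. y $ i)"
  using assms(2) sum_le_sum_dominating[OF assms(1)]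
  unfolding hypersimplex_eq_hull by (elim inner_le_on_hull[rotated]) (auto simp: inner_indicator_vec)

lemma support_function_hypersimplex:
  fixes y :: "real ^ 'n::finite"
  assumes "dominating S y"
  shows "support_function (hypersimplex (card S)) y = (\<Sum>i\<in>S. y $ i)"
proof (rule antisym)
  show "support_function (hypersimplex (card S)) y \<le> (\<Sum>i\<in>S. y $ i)"
    unfolding support_function_def
    using indicator_vec_in_hypersimplex inner_hypersimplex_le[OF assms] by (intro cSUP_least) auto
  show "(\<Sum>i\<in>S. y $ i) \<le> support_function (hypersimplex (card S)) y"
    using support_function_upper[OF polytope_hypersimplex indicator_vec_in_hypersimplex]
    by (metis inner_indicator_vec)
qed

section \<open>Indecomposability\<close>

text \<open>Support functions and linear functionals both qualify, so a linear correction can be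
  absorbed into a summand. Allowing \<open>c = 0\<close> forces \<open>f 0 = 0\<close>.\<close>

definition sublinear :: "('a::real_vector \<Rightarrow> real) \<Rightarrow> bool" where
  "sublinear f \<longleftrightarrow> (\<forall>y z. f (y + z) \<le> f y + f z) \<and> (\<forall>c y. c \<ge> 0 \<longrightarrow> f (c *\<^sub>R y) = c * f y)"

lemma sublinear_support_function:
  assumes "polytope Q" "Q \<noteq> {}"
  shows "sublinear (support_function Q)"
proof -
  have "support_function Q (c *\<^sub>R y) = c * support_function Q y" if "c \<ge> 0" for c y
    using support_function_scale[OF assms] that assms(2)
    by (cases "c = 0") (auto simp: support_function_def)
  with support_function_subadditive[OF assms] show ?thesis
    by (simp add: sublinear_def)
qed

lemma sublinear_linear: "linear f \<Longrightarrow> sublinear f"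
  by (simp add: sublinear_def linear_add linear_scale)

lemma sublinear_add:
  assumes "sublinear f" "sublinear g"
  shows "sublinear (\<lambda>y. f y + g y)"
  unfolding sublinear_def
proof (intro conjI allI impI)
  fix y z
  have "f (y + z) \<le> f y + f z" "g (y + z) \<le> g y + g z"
    using assms by (simp_all add: sublinear_def)
  then show "f (y + z) + g (y + z) \<le> f y + g y + (f z + g z)" by simp
qed (use assms in \<open>simp add: sublinear_def distrib_left\<close>)

lemma sublinear_mult: "c \<ge> 0 \<Longrightarrow> sublinear f \<Longrightarrow> sublinear (\<lambda>y. c * f y)"
  unfolding sublinear_def by (auto simp: distrib_left[symmetric] intro: mult_left_mono)

text \<open>The right-hand side is additive on \<open>C\<^sub>S\<close>, so the two subadditivity
  inequalities add up to an equality and each of them is tight.\<close>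

lemma sublinear_summand_of_hypersimplex_additive:
  fixes f g :: "real ^ 'n::finite \<Rightarrow> real"
  assumes "sublinear f" "sublinear g"
    and sum: "\<And>y. f y + g y = c * support_function (hypersimplex (card S)) y"
    and dom: "dominating S y" "dominating S z"
  shows "f (y + z) = f y + f z"
proof -
  have "f (y + z) + g (y + z) = (f y + g y) + (f z + g z)"
    unfolding sum using dom
    by (simp add: support_function_hypersimplex dominating_add sum.distrib distrib_left)
  moreover have "f (y + z) \<le> f y + f z" "g (y + z) \<le> g y + g z"
    using assms(1,2) by (auto simp: sublinear_def)
  ultimately show ?thesis by linarith
qed

text \<open>This writes \<open>y\<close> in the generators of \<open>C\<^sub>S\<close>, with
  \<open>1\<close> the all-ones vector. All coefficients except possibly \<open>t\<close> are
  nonnegative when \<open>t\<close> is a threshold for \<open>y\<close>.\<close>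

lemma vec_eq_threshold_expansion:
  fixes y :: "real ^ 'n::finite"
  shows "y = t *\<^sub>R 1 + ((\<Sum>i\<in>S. (y $ i - t) *\<^sub>R axis i 1) + (\<Sum>j\<in>-S. (t - y $ j) *\<^sub>R (- axis j 1)))"
proof -
  have *: "(\<Sum>i\<in>A. u i * (axis i 1 :: real ^ 'n) $ l) = (if l \<in> A then u l else 0)"
    for A u l
    by (simp add: axis_def if_distrib[of "\<lambda>x. _ * x"] sum.delta cong: if_cong)
  show ?thesis
    by (simp add: vec_eq_iff * sum_negf)
qed

lemma additive_on_dominating_cone:
  fixes f :: "real ^ 'n::finite \<Rightarrow> real"
  assumes scale: "\<And>c y. c \<ge> 0 \<Longrightarrow> f (c *\<^sub>R y) = c * f y"
    and add: "\<And>y z. dominating S y \<Longrightarrow> dominating S z \<Longrightarrow> f (y + z) = f y + f z"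
    and t: "\<And>i. i \<in> S \<Longrightarrow> t \<le> y $ i" "\<And>j. j \<notin> S \<Longrightarrow> y $ j \<le> t"
  shows "f y = t * f 1 + (\<Sum>i\<in>S. (y $ i - t) * f (axis i 1)) + (\<Sum>j\<in>-S. (t - y $ j) * f (- axis j 1))"
proof -
  have sum: "f (\<Sum>i\<in>A. u i) = (\<Sum>i\<in>A. f (u i))"
    if "\<And>i. i \<in> A \<Longrightarrow> dominating S (u i)" for A :: "'n set" and u
    using finite[of A] that
  proof induction
    case empty
    then show ?case using scale[of 0 0] by simp
  next
    case (insert i A)
    then show ?case by (simp add: add dominating_sum)
  qed
  have one: "dominating S (t *\<^sub>R 1)" for t
    by (simp add: dominating_def)
  have up: "dominating S ((y $ i - t) *\<^sub>R axis i 1)" if "i \<in> S" for i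
    using that t(1) by (intro dominating_scaleR) (auto simp: dominating_def axis_def)
  have down: "dominating S ((t - y $ j) *\<^sub>R (- axis j 1))" if "j \<in> - S" for j
    using that t(2) by (intro dominating_scaleR) (auto simp: dominating_def axis_def)
  \<comment> \<open>Both \<open>1\<close> and \<open>-1\<close> lie in the cone, so additivity
    extends homogeneity along this line to negative \<open>t\<close>.\<close>
  have f1: "f (t *\<^sub>R 1) = t * f 1"
  proof (cases "t \<ge> 0")
    case False
    have "f (t *\<^sub>R 1) + f ((-t) *\<^sub>R 1) = f 0"
      using add[OF one[of t] one[of "-t"]] by simp
    with False scale[of "-t" 1] scale[of 0 0] show ?thesis by simp
  qed (simp add: scale)
  have "f y = f (t *\<^sub>R 1) + (f (\<Sum>i\<in>S. (y $ i - t) *\<^sub>R axis i 1)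
      + f (\<Sum>j\<in>-S. (t - y $ j) *\<^sub>R (- axis j 1)))"
    by (subst vec_eq_threshold_expansion[of y t S])
       (simp only: add one up down dominating_sum dominating_add)
  also have "f (\<Sum>i\<in>S. (y $ i - t) *\<^sub>R axis i 1) = (\<Sum>i\<in>S. (y $ i - t) * f (axis i 1))"
    using t(1) by (subst sum) (auto intro: up simp: scale)
  also have "f (\<Sum>j\<in>-S. (t - y $ j) *\<^sub>R (- axis j 1)) = (\<Sum>j\<in>-S. (t - y $ j) * f (- axis j 1))"
    by (subst sum) (auto intro!: down sum.cong scale simp del: scaleR_minus_right simp: t(2))
  finally show ?thesis by (simp add: f1)
qed

lemma sublinear_summand_of_hypersimplex:
  fixes f g :: "real ^ 'n::finite \<Rightarrow> real"
  assumes k: "1 \<le> k" "k < CARD('n)"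
    and f: "sublinear f" and g: "sublinear g"
    and sum: "\<And>y. f y + g y = c0 * support_function (hypersimplex k) y"
  obtains c b where "c \<ge> 0" "\<And>y. f y = c * support_function (hypersimplex k) y + b \<bullet> y"
proof -
  let ?a = "\<lambda>i. f (axis i 1)" and ?b = "\<lambda>i. f (- axis i 1)"
  have scale: "f (s *\<^sub>R y) = s * f y" if "s \<ge> 0" for s y
    using f that by (simp add: sublinear_def)
  have expand: "f y = t * f 1 + (\<Sum>i\<in>S. (y $ i - t) * ?a i) + (\<Sum>j\<in>-S. (t - y $ j) * ?b j)"
    if "card S = k" "\<And>i. i \<in> S \<Longrightarrow> t \<le> y $ i" "\<And>j. j \<notin> S \<Longrightarrow> y $ j \<le> t" for S t y
    using additive_on_dominating_cone[of f S t y, OF scale]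
      sublinear_summand_of_hypersimplex_additive[OF f g] sum that by blast
  \<comment> \<open>Both 0 and 1 are thresholds for the indicator vector of \<open>S\<close>.
    Expanding with 0 leaves only the terms in \<open>S\<close>; expanding with 1 leaves
    \<open>f 1\<close> and the terms outside \<open>S\<close>.\<close>
  have indic: "(\<Sum>i\<in>S. ?a i) = f 1 + (\<Sum>j\<in>-S. ?b j)" if "card S = k" for S
    using expand[OF that, of 0 "indicator_vec S"] expand[OF that, of 1 "indicator_vec S"]
    by simp
  \<comment> \<open>The \<open>k\<close>-sets \<open>insert i R\<close> and
    \<open>insert j R\<close> differ by one exchange, and their complements share \<open>?W\<close>.
    Subtracting the two instances of \<open>indic\<close> cancels everything but the terms at
    \<open>i\<close> and \<open>j\<close>.\<close>
  have const: "?a i + ?b i = ?a j + ?b j" for i j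
  proof (cases "i = j")
    case False
    have "k - 1 \<le> card (UNIV - {i, j})"
      using k False by (simp add: card_Diff_subset)
    then obtain R where R: "R \<subseteq> UNIV - {i, j}" "card R = k - 1"
      by (rule obtain_subset_with_card_n)
    let ?W = "- insert i (insert j R)"
    have "- insert i R = insert j ?W" "- insert j R = insert i ?W"
      using R False by auto
    moreover have "card (insert i R) = k" "card (insert j R) = k"
      using R k by (auto simp: card_insert_if)
    ultimately have "(\<Sum>l\<in>insert i R. ?a l) = f 1 + (\<Sum>l\<in>insert j ?W. ?b l)"
      "(\<Sum>l\<in>insert j R. ?a l) = f 1 + (\<Sum>l\<in>insert i ?W. ?b l)"
      using indic by metis+
    moreover have "i \<notin> R" "j \<notin> R" using R by auto
    ultimately show ?thesis by simp
  qed simp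
  obtain i0 :: 'n where True by simp
  define c where "c = ?a i0 + ?b i0"
  have a: "?a i = c - ?b i" for i
    using const[of i i0] by (simp add: c_def)
  show ?thesis
  proof
    \<comment> \<open>Subadditivity at \<open>axis i0 1\<close> and its negative.\<close>
    have "f 0 \<le> c"
      using f unfolding sublinear_def c_def by (metis add.right_inverse)
    then show "c \<ge> 0" using scale[of 0 0] by simp
    fix y :: "real ^ 'n"
    obtain S where S: "card S = k" "dominating S y"
      by (rule ex_dominating[OF less_imp_le[OF k(2)]])
    obtain t where t: "\<And>i. i \<in> S \<Longrightarrow> t \<le> y $ i" "\<And>j. j \<notin> S \<Longrightarrow> y $ j \<le> t"
      using dominating_threshold[OF S(2)] by blast
    have split: "(\<Sum>i\<in>UNIV. u i) = (\<Sum>i\<in>S. u i) + (\<Sum>i\<in>-S. u i)" for u :: "'n \<Rightarrow> real"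
      by (metis Compl_eq_Diff_UNIV finite sum.subset_diff top_greatest add.commute)
    \<comment> \<open>Substituting \<open>?a i = c - ?b i\<close> into \<open>indic\<close> gives
      the value of \<open>f 1\<close> that makes the threshold \<open>t\<close> cancel from the
      expansion of \<open>f y\<close>.\<close>
    have d: "f 1 = k * c - (\<Sum>i\<in>UNIV. ?b i)"
      using indic[OF S(1)] S(1) by (simp add: a sum_subtractf split)
    have "f y = c * (\<Sum>i\<in>S. y $ i) - (\<Sum>i\<in>UNIV. ?b i * y $ i)"
    proof -
      have "(\<Sum>i\<in>S. (y $ i - t) * ?a i)
          = c * (\<Sum>i\<in>S. y $ i) - t * (k * c) - (\<Sum>i\<in>S. ?b i * y $ i) + t * (\<Sum>i\<in>S. ?b i)"
        unfolding a using S(1) by (simp add: algebra_simps sum_subtractf sum.distrib sum_distrib_left)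
      moreover have "(\<Sum>j\<in>-S. (t - y $ j) * ?b j)
          = t * (\<Sum>j\<in>-S. ?b j) - (\<Sum>j\<in>-S. ?b j * y $ j)"
        by (simp add: algebra_simps sum_subtractf sum_distrib_left)
      moreover have "f y = t * f 1 + (\<Sum>i\<in>S. (y $ i - t) * ?a i) + (\<Sum>j\<in>-S. (t - y $ j) * ?b j)"
        by (rule expand[OF S(1) t])
      ultimately show ?thesis
        by (simp only: d split) (simp add: distrib_left right_diff_distrib)
    qed
    then show "f y = c * support_function (hypersimplex k) y + (\<chi> i. - ?b i) \<bullet> y"
      using support_function_hypersimplex[OF S(2)] S(1)
      by (simp add: inner_vec_def sum_negf)
  qed
qed

section \<open>Deformations of the permutahedron\<close>

definition swap_coords :: "'n \<Rightarrow> 'n \<Rightarrow> 'a ^ 'n \<Rightarrow> 'a ^ 'n" where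
  "swap_coords i j v = (\<chi> l. v $ (Transposition.transpose i j l))"

lemma finite_vec_of_finite:
  assumes "finite B"
  shows "finite {x :: 'a ^ 'n::finite. \<forall>i. x $ i \<in> B}"
proof -
  have "{x :: 'a ^ 'n. \<forall>i. x $ i \<in> B} \<subseteq> vec_lambda ` (PiE UNIV (\<lambda>_. B))"
  proof
    fix x :: "'a ^ 'n" assume "x \<in> {x. \<forall>i. x $ i \<in> B}"
    then have "vec_nth x \<in> PiE UNIV (\<lambda>_. B)" by auto
    then show "x \<in> vec_lambda ` (PiE UNIV (\<lambda>_. B))"
      by (metis imageI vec_nth_inverse)
  qed
  then show ?thesis
    using assms by (meson finite finite_PiE finite_imageI finite_subset)
qed

abbreviation permutation_vecs :: "(real ^ 'n) set" where
  "permutation_vecs \<equiv> {x. bij_betw (\<lambda>i. x $ i) UNIV (real ` {1..CARD('n)})}"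

lemma finite_permutation_vecs: "finite (permutation_vecs :: (real ^ 'n::finite) set)"
proof (rule finite_subset)
  show "finite {x :: real ^ 'n. \<forall>i. x $ i \<in> real ` {1..CARD('n)}}"
    by (intro finite_vec_of_finite) simp
qed (auto dest: bij_betwE)

lemma permutation_vecs_nonempty: "(permutation_vecs :: (real ^ 'n::finite) set) \<noteq> {}"
proof -
  have "card (UNIV :: 'n set) = card (real ` {1..CARD('n)})"
    by (simp add: card_image)
  then obtain h where "bij_betw h (UNIV :: 'n set) (real ` {1..CARD('n)})"
    using finite_same_card_bij by (metis finite finite_imageI finite_atLeastAtMost)
  then have "(\<chi> i. h i) \<in> permutation_vecs" by (simp add: vec_lambda_inverse)
  then show ?thesis by blast
qed

lemma swap_coords_permutation_vecs:
  assumes "v \<in> permutation_vecs"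
  shows "swap_coords i j v \<in> permutation_vecs"
  using bij_betw_trans[OF bij_transpose[of i j]] assms
  by (fastforce simp: swap_coords_def o_def)

text \<open>The rearrangement inequality for one transposition in exact form: only the positions
  \<open>i\<close> and \<open>j\<close> contribute.\<close>

lemma inner_swap_coords:
  fixes y v :: "real ^ 'n::finite"
  shows "y \<bullet> v - y \<bullet> swap_coords i j v = (y $ i - y $ j) * (v $ i - v $ j)"
proof (cases "i = j")
  case False
  have "y \<bullet> v - y \<bullet> swap_coords i j v = (\<Sum>l\<in>UNIV. y $ l * (v $ l - swap_coords i j v $ l))"
    by (simp add: inner_vec_def sum_subtractf right_diff_distrib)
  also have "\<dots> = (\<Sum>l\<in>{i, j}. y $ l * (v $ l - swap_coords i j v $ l))"
    by (rule sum.mono_neutral_right) (auto simp: swap_coords_def)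
  also have "\<dots> = (y $ i - y $ j) * (v $ i - v $ j)"
    using False by (simp add: swap_coords_def algebra_simps)
  finally show ?thesis .
qed (simp add: swap_coords_def)

lemma normal_cone_permutahedron_order:
  fixes y z :: "real ^ 'n::finite"
  assumes z: "z \<in> normal_cone permutahedron {x \<in> permutahedron. \<forall>w\<in>permutahedron. y \<bullet> w \<le> y \<bullet> x}"
    and ij: "y $ j \<le> y $ i"
  shows "z $ j \<le> z $ i"
proof (cases "i = j")
  case False
  let ?V = "permutation_vecs :: (real ^ 'n) set"
  obtain v0 where v0: "v0 \<in> ?V" "\<And>w. w \<in> ?V \<Longrightarrow> y \<bullet> w \<le> y \<bullet> v0"
    using finite_obtains_maximizer[OF finite_permutation_vecs permutation_vecs_nonempty] by metis
  have ne: "v $ i \<noteq> v $ j" if "v \<in> ?V" for v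
    using that False by (auto simp: bij_betw_def inj_def)
  \<comment> \<open>If \<open>v0\<close> orders the two positions the wrong way, swapping them does
    not lower the objective because \<open>y $ j \<le> y $ i\<close>, so the swapped vertex is a
    maximizer too.\<close>
  obtain v where v: "v \<in> ?V" "\<And>w. w \<in> ?V \<Longrightarrow> y \<bullet> w \<le> y \<bullet> v" "v $ j < v $ i"
  proof (cases "v0 $ j < v0 $ i")
    case False
    show ?thesis
    proof (rule that[of "swap_coords i j v0"])
      show "swap_coords i j v0 \<in> ?V"
        by (rule swap_coords_permutation_vecs[OF v0(1)])
      have "y \<bullet> v0 \<le> y \<bullet> swap_coords i j v0"
        using inner_swap_coords[of y v0 i j] False ij
          mult_nonneg_nonpos[of "y $ i - y $ j" "v0 $ i - v0 $ j"] by simp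
      then show "y \<bullet> w \<le> y \<bullet> swap_coords i j v0" if "w \<in> ?V" for w
        using v0(2)[OF that] by simp
      show "swap_coords i j v0 $ j < swap_coords i j v0 $ i"
        using False ne[OF v0(1)] by (simp add: swap_coords_def)
    qed
  qed (use v0 that in blast)
  have V: "?V \<subseteq> permutahedron"
    unfolding permutahedron_def by (rule hull_subset)
  have "\<forall>w\<in>permutahedron. y \<bullet> w \<le> y \<bullet> v"
    using inner_le_on_hull[of ?V y "y \<bullet> v"] v(2) by (auto simp: permutahedron_def)
  moreover have "swap_coords i j v \<in> permutahedron"
    using swap_coords_permutation_vecs[OF v(1)] V by blast
  \<comment> \<open>\<open>v\<close> lies in the face maximizing \<open>y\<close>, where
    \<open>z\<close> is also maximal; hence the swap cannot raise the value of
    \<open>z\<close>.\<close>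
  ultimately have "z \<bullet> swap_coords i j v \<le> z \<bullet> v"
    using z v(1) V by (auto simp: normal_cone_def)
  then have "0 \<le> (z $ i - z $ j) * (v $ i - v $ j)"
    using inner_swap_coords[of z v i j] by simp
  with v(3) show ?thesis by (simp add: zero_le_mult_iff)
qed simp

lemma polytope_permutahedron: "polytope (permutahedron :: (real ^ 'n::finite) set)"
  unfolding polytope_def permutahedron_def using finite_permutation_vecs by blast

text \<open>A normal cone \<open>C\<close> of \<open>Q\<close> is the union, over
  \<open>y \<in> C\<close>, of the normal cones at the faces of the permutahedron maximizing
  \<open>y\<close>. Each contains \<open>y\<close>; it stays inside \<open>C\<close> because its
  elements are weakly ordered like \<open>y\<close> and so, by \<open>max\<close>, are maximal
  wherever \<open>y\<close> is.\<close>

lemma deformation_of_permutahedronI: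
  fixes Q :: "(real ^ 'n::finite) set"
  assumes Q: "polytope Q" "Q \<noteq> {}"
    and max: "\<And>y z x w. \<lbrakk>\<And>i j. y $ j \<le> y $ i \<Longrightarrow> z $ j \<le> z $ i; x \<in> Q;
      \<And>w. w \<in> Q \<Longrightarrow> y \<bullet> w \<le> y \<bullet> x; w \<in> Q\<rbrakk> \<Longrightarrow> z \<bullet> w \<le> z \<bullet> x"
  shows "Q deformation_of permutahedron"
  unfolding deformation_of_def
proof (intro conjI ballI)
  fix C assume "C \<in> normal_fan Q"
  then obtain F where F: "C = normal_cone Q F" "F \<subseteq> Q"
    by (auto simp: normal_fan_def dest: face_of_imp_subset)
  let ?P = "permutahedron :: (real ^ 'n) set"
  define G where "G y = {x \<in> ?P. \<forall>w\<in>?P. y \<bullet> w \<le> y \<bullet> x}" for y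
  have "normal_cone ?P (G y) \<in> normal_fan ?P" for y
  proof -
    have "?P \<noteq> {}"
      unfolding permutahedron_def using permutation_vecs_nonempty by simp
    moreover have "continuous_on ?P (\<lambda>x. y \<bullet> x)" by (intro continuous_intros)
    ultimately obtain x where x: "x \<in> ?P" "\<forall>w\<in>?P. y \<bullet> w \<le> y \<bullet> x"
      using continuous_attains_sup[OF polytope_imp_compact[OF polytope_permutahedron]] by blast
    have G: "G y = ?P \<inter> {w. y \<bullet> w = y \<bullet> x}"
      unfolding G_def using x by (auto intro: antisym)
    have "G y face_of ?P"
      unfolding G using x
      by (intro face_of_Int_supporting_hyperplane_le polytope_imp_convex polytope_permutahedron) auto
    moreover have "G y \<noteq> {}" using x by (auto simp: G)
    ultimately show ?thesis by (auto simp: normal_fan_def)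
  qed
  moreover have "y \<in> normal_cone ?P (G y)" for y
    by (auto simp: normal_cone_def G_def)
  moreover have "normal_cone ?P (G y) \<subseteq> C" if "y \<in> C" for y
  proof
    fix z assume "z \<in> normal_cone ?P (G y)"
    then have "z $ j \<le> z $ i" if "y $ j \<le> y $ i" for i j
      using normal_cone_permutahedron_order that by (auto simp: G_def)
    then show "z \<in> C"
      using max[of y z] that F by (auto simp: normal_cone_def subset_iff)
  qed
  ultimately show "\<exists>\<S>\<subseteq>normal_fan ?P. C = \<Union>\<S>"
    by (intro exI[of _ "(\<lambda>y. normal_cone ?P (G y)) ` C"]) auto
qed (use Q in auto)

text \<open>The face maximizing \<open>y\<close> is the hull of the vertices in it. The support of
  each such vertex dominates \<open>y\<close>, hence also \<open>z\<close>, so \<open>z\<close> is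
  maximal at these vertices and therefore at \<open>x\<close>.\<close>

lemma maximizer_hypersimplex_order_mono:
  fixes x y z :: "real ^ 'n::finite"
  assumes order: "\<And>i j. y $ j \<le> y $ i \<Longrightarrow> z $ j \<le> z $ i"
    and x: "x \<in> hypersimplex k" "\<And>w. w \<in> hypersimplex k \<Longrightarrow> y \<bullet> w \<le> y \<bullet> x"
    and w: "w \<in> hypersimplex k"
  shows "z \<bullet> w \<le> z \<bullet> x"
proof -
  let ?H = "hypersimplex k :: (real ^ 'n) set" and ?V = "indicator_vec ` {S :: 'n set. card S = k}"
  let ?M = "?H \<inter> {w. y \<bullet> w = y \<bullet> x}"
  have "?M face_of convex hull ?V"
    unfolding hypersimplex_eq_hull[symmetric]
    using x by (intro face_of_Int_supporting_hyperplane_le polytope_imp_convex polytope_hypersimplex) auto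
  then obtain V' where V': "V' \<subseteq> ?V" "?M = convex hull V'"
    using face_of_convex_hull_subset[of ?V ?M] by (auto simp: finite_imp_compact)
  \<comment> \<open>The negated form lets the upper bound on a hull serve as a lower bound for
    \<open>z\<close> at \<open>x\<close>.\<close>
  have "- z \<bullet> v \<le> - (z \<bullet> w)" if v: "v \<in> V'" for v
  proof -
    obtain S where S: "v = indicator_vec S" "card S = k"
      using v V'(1) by blast
    have "y \<bullet> v = y \<bullet> x"
      using v V'(2) hull_inc[of v V'] by auto
    then have "(\<Sum>i\<in>T. y $ i) \<le> (\<Sum>i\<in>S. y $ i)" if "card T = card S" for T
      using x(2)[of "indicator_vec T"] indicator_vec_in_hypersimplex[of T] that S
      by (simp add: inner_indicator_vec)
    then have "dominating S y" by (rule dominating_if_sum_maximal)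
    then have "dominating S z" using order by (auto simp: dominating_def)
    from inner_hypersimplex_le[OF this] show ?thesis
      using w S by (simp add: inner_indicator_vec sum_negf)
  qed
  moreover have "x \<in> convex hull V'" using x V'(2) by blast
  ultimately have "- z \<bullet> x \<le> - (z \<bullet> w)" by (rule inner_le_on_hull)
  then show ?thesis by simp
qed

text \<open>Positive dilation preserves maximizers. The case \<open>c = 0\<close> gives the single
  point 0, which represents the apex of the ray.\<close>

lemma scaled_hypersimplex_deformation:
  assumes "k \<le> CARD('n::finite)" "c \<ge> 0"
  shows "((\<lambda>x. c *\<^sub>R x) ` (hypersimplex k :: (real ^ 'n) set)) deformation_of permutahedron"
proof (rule deformation_of_permutahedronI)
  show "polytope ((\<lambda>x. c *\<^sub>R x) ` (hypersimplex k :: (real ^ 'n) set))"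
    by (intro polytope_linear_image polytope_hypersimplex linear_scaleR)
  show "(\<lambda>x. c *\<^sub>R x) ` (hypersimplex k :: (real ^ 'n) set) \<noteq> {}"
    using hypersimplex_nonempty[OF assms(1)] by simp
next
  fix y z x w :: "real ^ 'n"
  assume order: "\<And>i j. y $ j \<le> y $ i \<Longrightarrow> z $ j \<le> z $ i"
    and x: "x \<in> (\<lambda>x. c *\<^sub>R x) ` hypersimplex k"
    and max: "\<And>w. w \<in> (\<lambda>x. c *\<^sub>R x) ` hypersimplex k \<Longrightarrow> y \<bullet> w \<le> y \<bullet> x"
    and w: "w \<in> (\<lambda>x. c *\<^sub>R x) ` hypersimplex k"
  obtain x' where x': "x = c *\<^sub>R x'" "x' \<in> hypersimplex k" using x by blast
  obtain w' where w': "w = c *\<^sub>R w'" "w' \<in> hypersimplex k" using w by blast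
  show "z \<bullet> w \<le> z \<bullet> x"
  proof (cases "c = 0")
    case False
    with assms have "c > 0" by simp
    then have "y \<bullet> u \<le> y \<bullet> x'" if "u \<in> hypersimplex k" for u
      using max[of "c *\<^sub>R u"] that x'(1) by simp
    then have "z \<bullet> w' \<le> z \<bullet> x'"
      using maximizer_hypersimplex_order_mono[OF order x'(2)] w'(2) by blast
    then show ?thesis using \<open>c > 0\<close> by (simp add: x' w')
  qed (simp add: x' w')
qed

lemma support_function_scaleR_image:
  assumes "polytope Q" "Q \<noteq> {}" "c \<ge> 0"
  shows "support_function ((\<lambda>x. c *\<^sub>R x) ` Q) y = c * support_function Q y"
proof -
  have "support_function ((\<lambda>x. c *\<^sub>R x) ` Q) y = support_function Q (c *\<^sub>R y)"
    by (simp add: support_function_def image_image)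
  then show ?thesis
    using sublinear_support_function[OF assms(1,2)] assms(3) by (simp add: sublinear_def)
qed

text \<open>These two values show that the support function is not odd, hence not linear. Dominating
  sets of size \<open>k\<close> exist both with and without \<open>i\<close> because
  \<open>1 \<le> k < n\<close>.\<close>

lemma support_function_hypersimplex_axis:
  assumes "1 \<le> k" "k < CARD('n::finite)"
  shows "support_function (hypersimplex k) (axis i 1 :: real ^ 'n) = 1"
    and "support_function (hypersimplex k) (- axis i 1 :: real ^ 'n) = 0"
proof -
  have "k - 1 \<le> card (- {i})" "k \<le> card (- {i})"
    using assms by (simp_all add: Compl_eq_Diff_UNIV)
  then obtain R T where R: "R \<subseteq> - {i}" "card R = k - 1" and T: "T \<subseteq> - {i}" "card T = k"
    by (meson obtain_subset_with_card_n)
  have i: "i \<notin> R" "i \<notin> T" using R T by auto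
  have "card (insert i R) = k" using i R assms by simp
  moreover have "dominating (insert i R) (axis i 1)"
    by (auto simp: dominating_def axis_def)
  ultimately have "support_function (hypersimplex k) (axis i 1 :: real ^ 'n)
      = (\<Sum>l\<in>insert i R. axis i 1 $ l)"
    using support_function_hypersimplex by metis
  also have "\<dots> = 1" using i by (simp add: axis_def sum.neutral)
  finally show "support_function (hypersimplex k) (axis i 1 :: real ^ 'n) = 1" .
  have "dominating T (- axis i 1)"
    using i by (auto simp: dominating_def axis_def)
  then have "support_function (hypersimplex k) (- axis i 1 :: real ^ 'n) = (\<Sum>l\<in>T. (- axis i 1) $ l)"
    using support_function_hypersimplex T by metis
  also have "\<dots> = 0" using i by (auto simp: axis_def intro!: sum.neutral)
  finally show "support_function (hypersimplex k) (- axis i 1 :: real ^ 'n) = 0" .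
qed

section \<open>The ray of the hypersimplex\<close>

lemma mod_linear_eq_iff: "mod_linear f = mod_linear g \<longleftrightarrow> linear (\<lambda>y. f y - g y)"
  by (rule fun_mod_linear.abs_eq_iff)

lemma dim_cone_hull_singleton:
  fixes r :: "'a::real_vector"
  assumes "r \<noteq> 0"
  shows "dim (cone hull {r}) = 1"
proof (rule dim_unique[of "{r}"])
  show "cone hull {r} \<subseteq> span {r}"
    by (auto simp: cone_hull_expl span_singleton)
qed (use assms in \<open>auto simp: hull_inc\<close>)

theorem hypersimplex_ray:
  fixes k :: nat
  assumes k: "1 \<le> k" "k < CARD('n::finite)"
  defines "r \<equiv> mod_linear (support_function (hypersimplex k :: (real ^ 'n) set))"
  shows "r \<noteq> 0"
    and "(cone hull {r}) face_of (essential_deformation_cone permutahedron)"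
proof -
  let ?\<Delta> = "hypersimplex k :: (real ^ 'n) set"
  have ne: "?\<Delta> \<noteq> {}" using hypersimplex_nonempty k by (metis less_imp_le)
  have ray: "cone hull {r} = {c *\<^sub>R r | c. c \<ge> 0}"
    by (auto simp: cone_hull_expl)
  have smul: "c *\<^sub>R r = mod_linear (\<lambda>y. c * support_function ?\<Delta> y)" for c
    by (simp add: r_def scaleR_fun_mod_linear.abs_eq)
  show "r \<noteq> 0"
  proof
    assume "r = 0"
    then have "linear (support_function ?\<Delta>)"
      by (simp add: r_def mod_linear_eq_0_iff)
    then show False
      using linear_neg[of "support_function ?\<Delta>" "axis undefined 1"]
        support_function_hypersimplex_axis[OF k] by simp
  qed
  have summand: "mod_linear (support_function A) \<in> cone hull {r}"
    if A: "polytope A" "A \<noteq> {}" and B: "polytope B" "B \<noteq> {}" and u: "0 < u" "u < 1"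
      and eq: "c0 *\<^sub>R r
        = (1 - u) *\<^sub>R mod_linear (support_function A) + u *\<^sub>R mod_linear (support_function B)"
    for A B :: "(real ^ 'n) set" and u c0
  proof -
    let ?f = "\<lambda>y. (1 - u) * support_function A y"
    \<comment> \<open>Equality of classes holds only up to a linear functional. This is that defect;
      adding it to the \<open>B\<close> summand gives an exact identity of functions.\<close>
    define l where
      "l y = c0 * support_function ?\<Delta> y - (?f y + u * support_function B y)" for y
    have "linear l"
      using eq unfolding smul l_def
      by (simp add: scaleR_fun_mod_linear.abs_eq plus_fun_mod_linear.abs_eq mod_linear_eq_iff)
    then have "sublinear (\<lambda>y. u * support_function B y + l y)"
      using u sublinear_support_function[OF B]
      by (auto intro!: sublinear_add sublinear_mult intro: sublinear_linear)
    moreover have "sublinear ?f"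
      using u sublinear_support_function[OF A] by (intro sublinear_mult) auto
    moreover have "?f y + (u * support_function B y + l y) = c0 * support_function ?\<Delta> y" for y
      by (simp add: l_def)
    ultimately obtain c b where cb: "c \<ge> 0" "\<And>y. ?f y = c * support_function ?\<Delta> y + b \<bullet> y"
      using sublinear_summand_of_hypersimplex[OF k, of ?f "\<lambda>y. u * support_function B y + l y" c0]
      by blast
    have "linear (\<lambda>y. support_function A y - c / (1 - u) * support_function ?\<Delta> y)"
    proof -
      have "support_function A y - c / (1 - u) * support_function ?\<Delta> y = (b /\<^sub>R (1 - u)) \<bullet> y" for y
        using cb(2)[of y] u by (simp add: field_simps)
      then show ?thesis
        by (simp only: bounded_linear.linear[OF bounded_linear_inner_right])
    qed
    then have "mod_linear (support_function A) = (c / (1 - u)) *\<^sub>R r"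
      unfolding smul by (simp add: mod_linear_eq_iff)
    then show ?thesis
      using cb(1) u unfolding ray by auto
  qed
  show "(cone hull {r}) face_of (essential_deformation_cone permutahedron)"
    unfolding face_of_def
  proof (intro conjI ballI impI)
    show "cone hull {r} \<subseteq> essential_deformation_cone permutahedron"
    proof
      fix x assume "x \<in> cone hull {r}"
      then obtain c where c: "c \<ge> 0" "x = c *\<^sub>R r" unfolding ray by blast
      \<comment> \<open>Nonnegative multiples of \<open>r\<close> are realized by dilates of the
        hypersimplex.\<close>
      have "x = mod_linear (support_function ((\<lambda>x. c *\<^sub>R x) ` ?\<Delta>))"
        unfolding c smul using support_function_scaleR_image[OF polytope_hypersimplex ne c(1)]
        by presburger
      then show "x \<in> essential_deformation_cone permutahedron"
        using scaled_hypersimplex_deformation[OF less_imp_le[OF k(2)] c(1)]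
        by (auto simp: essential_deformation_cone_def deformation_cone_def)
    qed
    show "convex (cone hull {r})"
      by (intro convex_cone_hull) simp
    fix a b x
    assume "a \<in> essential_deformation_cone permutahedron"
      "b \<in> essential_deformation_cone permutahedron"
      and "x \<in> cone hull {r}" "x \<in> open_segment a b"
    then obtain A B c0 u where AB: "a = mod_linear (support_function A)"
      "b = mod_linear (support_function B)" "polytope A" "A \<noteq> {}" "polytope B" "B \<noteq> {}"
      and u: "0 < u" "u < 1" and eq: "c0 *\<^sub>R r = (1 - u) *\<^sub>R a + u *\<^sub>R b"
      unfolding ray by (auto simp: essential_deformation_cone_def deformation_cone_def
          deformation_of_def in_segment)
    show "a \<in> cone hull {r}"
      using summand[of A B u c0] AB u eq by blast
    \<comment> \<open>Reversing the segment exchanges the endpoints and replaces \<open>u\<close> by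
      \<open>1 - u\<close>.\<close>
    show "b \<in> cone hull {r}"
      using summand[of B A "1 - u" c0] AB u eq by (simp add: add.commute)
  qed
qed

theorem mainTheorem2:
  fixes k :: nat
  assumes "k \<ge> 1" and "CARD('n::finite) = 2 * k"
  defines "\<Delta> \<equiv> (hypersimplex k :: (real ^ 'n) set)"
  defines "r \<equiv> mod_linear (support_function \<Delta>)"
  shows "\<Delta> deformation_of permutahedron
    \<and> r \<noteq> 0
    \<and> (cone hull {r}) face_of (essential_deformation_cone permutahedron)
    \<and> dim (cone hull {r}) = 1"
proof -
  have k: "1 \<le> k" "k < CARD('n)" using assms(1,2) by auto
  have "\<Delta> deformation_of permutahedron"
    using scaled_hypersimplex_deformation[of k 1, where 'n = 'n] k by (simp add: \<Delta>_def)
  then show ?thesis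
    using hypersimplex_ray[OF k] dim_cone_hull_singleton[of r] by (simp add: r_def \<Delta>_def)
qed

end
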